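(* Let $N\geq 3$ and let $\mathcal{P}$ be a polygon with $N$ vertices $P_1,\ldots,P_N$. Let $\psi(\theta):=\csc(\theta)+\cot(\theta)$. (1) If for all $i\in\{1,\ldots,N\}$ $$\frac{1}{\ell_i}\Big(\psi(\theta_i)+\psi(\theta_{i+1})\Big)=\frac{\mathrm{Per}(\mathcal{P})}{2\,\mathrm{Area}(\mathcal{P})}\qquad\text{and}\qquad \psi(\theta_i)-\psi(\theta_{i+1})=0,$$ then $\mathcal{P}$ is a regular polygon. (2) If for all $i\in\{1,\ldots,N\}$ $$\psi(\theta_i)-\psi(\theta_{i+1})=0\qquad\text{and}\qquad \cos\alpha_i^- -\cos\alpha_i^+=0,$$ then $\mathcal{P}$ is a regular polygon.
   Context: A polygon is an open and bounded region of the plane $\mathbb{R}^2$ whose boundary is a closed, connected curve consisting of finitely many line segments (sides), where only consecutive segments intersect, at their endpoints (vertices). In particular polygons are simple but not assumed convex. Consecutive sides are not collinear, so every interior angle lies in $(0,2\pi)\setminus\{\pi\}$. The vertices $P_1,\ldots,P_N$ are listed in consecutive order along the boundary, and indices are understood cyclically modulo $N$ (so $P_0=P_N$, $P_{N+1}=P_1$, $\theta_{N+1}=\theta_1$). For $i\in\{1,\ldots,N\}$: $\ell_i$ is the length of the side $\overline{P_iP_{i+1}}$; $\theta_i$ is the interior angle of $\mathcal{P}$ at the vertex $P_i$; $\alpha_i^-\in(0,\pi)$ is the angle at $P_{i-1}$ between the segments $\overline{P_{i-1}P_{i+1}}$ and $\overline{P_{i-1}P_i}$; $\alpha_i^+\in(0,\pi)$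 is the angle at $P_{i+1}$ between the segments $\overline{P_{i-1}P_{i+1}}$ and $\overline{P_iP_{i+1}}$. $\mathrm{Per}(\mathcal{P})$ is the perimeter and $\mathrm{Area}(\mathcal{P})$ the area of $\mathcal{P}$. A polygon is regular if all its sides have equal length and all its interior angles are equal. *)

theory Defs
  imports "HOL-Analysis.Analysis"
begin

(* The vertices P_1, ..., P_N are encoded as an N-periodic function on the integers,
   so that cyclic indices need no reduction. *)

definition is_polygon :: "nat \<Rightarrow> (int \<Rightarrow> real^2) \<Rightarrow> (real^2) set \<Rightarrow> bool" where
  "is_polygon N p P \<longleftrightarrow>
     (\<forall>i. p (i + int N) = p i) \<and>
     open P \<and> connected P \<and> bounded P \<and>
     frontier P = (\<Union>i\<in>{1..int N}. closed_segment (p i) (p (i + 1))) \<and>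
     (\<forall>i. closed_segment (p (i - 1)) (p i) \<inter> closed_segment (p i) (p (i + 1)) = {p i}) \<and>
     (\<forall>i j. (j - i) mod int N \<notin> {0, 1, int N - 1} \<longrightarrow>
        closed_segment (p i) (p (i + 1)) \<inter> closed_segment (p j) (p (j + 1)) = {}) \<and>
     (\<forall>i. \<not> collinear {p (i - 1), p i, p (i + 1)})"

definition side_length :: "(int \<Rightarrow> real^2) \<Rightarrow> int \<Rightarrow> real" where
  "side_length p i = dist (p i) (p (i + 1))"

definition perimeter :: "nat \<Rightarrow> (int \<Rightarrow> real^2) \<Rightarrow> real" where
  "perimeter N p = (\<Sum>i\<in>{1..int N}. side_length p i)"

definition area :: "(real^2) set \<Rightarrow> real" where
  "area P = measure lebesgue P"

(* Unoriented angle in [0, pi] at V between the segments VA and VB. *)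
definition angle_at :: "real^2 \<Rightarrow> real^2 \<Rightarrow> real^2 \<Rightarrow> real" where
  "angle_at A V B = arccos (((A - V) \<bullet> (B - V)) / (norm (A - V) * norm (B - V)))"

(* The rays VA and VB bound a convex and a reflex open sector; near a vertex V of a polygon,
   exactly one of them lies in P. The interior angle is the opening of that sector. *)
definition convex_corner :: "(real^2) set \<Rightarrow> real^2 \<Rightarrow> real^2 \<Rightarrow> real^2 \<Rightarrow> bool" where
  "convex_corner P A V B \<longleftrightarrow>
     (\<exists>e>0. \<forall>a b. 0 < a \<and> 0 < b \<and> a + b < e \<longrightarrow>
        V + a *\<^sub>R (A - V) + b *\<^sub>R (B - V) \<in> P)"

definition interior_angle :: "(int \<Rightarrow> real^2) \<Rightarrow> (real^2) set \<Rightarrow> int \<Rightarrow> real" where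
  "interior_angle p P i =
     (if convex_corner P (p (i - 1)) (p i) (p (i + 1))
      then angle_at (p (i - 1)) (p i) (p (i + 1))
      else 2 * pi - angle_at (p (i - 1)) (p i) (p (i + 1)))"

definition alpha_minus :: "(int \<Rightarrow> real^2) \<Rightarrow> int \<Rightarrow> real" where
  "alpha_minus p i = angle_at (p (i + 1)) (p (i - 1)) (p i)"

definition alpha_plus :: "(int \<Rightarrow> real^2) \<Rightarrow> int \<Rightarrow> real" where
  "alpha_plus p i = angle_at (p (i - 1)) (p (i + 1)) (p i)"

definition psi :: "real \<Rightarrow> real" where
  "psi \<theta> = 1 / sin \<theta> + cot \<theta>"

definition is_regular_polygon :: "nat \<Rightarrow> (int \<Rightarrow> real^2) \<Rightarrow> (real^2) set \<Rightarrow> bool" where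
  "is_regular_polygon N p P \<longleftrightarrow>
     is_polygon N p P \<and>
     (\<forall>i\<in>{1..int N}. \<forall>j\<in>{1..int N}.
        side_length p i = side_length p j \<and> interior_angle p P i = interior_angle p P j)"

end

theory Submission
  imports Defs
begin

text \<open>
  The half-angle formula \<open>csc \<theta> + cot \<theta> = cot (\<theta>/2)\<close> is the key to both parts. The
  cotangent is injective on \<open>(0, \<pi>)\<close>, so on \<open>(0, 2\<pi>)\<close> the value \<open>psi \<theta>\<close> determines \<open>\<theta>\<close>, and it
  vanishes only at \<open>\<theta> = \<pi>\<close> (lemmas \<open>psi_inj\<close> and \<open>psi_nonzero\<close>). Since consecutive sides of a
  polygon are not collinear, every interior angle lies in \<open>(0, 2\<pi>) - {\<pi>}\<close>. Hence the equations
  \<open>psi \<theta>\<^sub>i = psi \<theta>\<^sub>i\<^sub>+\<^sub>1\<close> force all interior angles to be equal.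

  It remains to compare the sides. In part (1) the common value \<open>c\<close> of \<open>psi\<close> is nonzero, and
  \<open>2 c / l\<^sub>i\<close> does not depend on \<open>i\<close>, so neither does \<open>l\<^sub>i\<close>. In part (2) the triangle
  \<open>P\<^sub>i\<^sub>-\<^sub>1 P\<^sub>i P\<^sub>i\<^sub>+\<^sub>1\<close> has equal angles at \<open>P\<^sub>i\<^sub>-\<^sub>1\<close> and \<open>P\<^sub>i\<^sub>+\<^sub>1\<close>, so it is isosceles
  (lemma \<open>isosceles_if_cos_angles_eq\<close>) and neighbouring sides have the same length.
\<close>

lemma psi_eq_cot_half: "psi t = cot (t / 2)"
proof -
  have s: "sin t = 2 * sin (t/2) * cos (t/2)" and c: "cos t = 2 * (cos (t/2))\<^sup>2 - 1"
    using sin_double[of "t/2"] cos_double_cos[of "t/2"] by simp_all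
  have "psi t = (1 + cos t) / sin t"
    by (simp add: psi_def cot_def add_divide_distrib)
  also have "\<dots> = cos (t/2) / sin (t/2)"
    unfolding s c by (simp add: power2_eq_square)
  finally show ?thesis by (simp add: cot_def)
qed

lemma psi_inj:
  assumes "0 < s" "s < 2 * pi" "0 < t" "t < 2 * pi" "psi s = psi t"
  shows "s = t"
proof -
  have "sin (s/2) > 0" "sin (t/2) > 0"
    using assms by (auto intro!: sin_gt_zero)
  then have "sin (t/2 - s/2) = 0"
    using assms(5) unfolding psi_eq_cot_half cot_def sin_diff
    by (simp add: field_simps)
  moreover have "- pi < t/2 - s/2" "t/2 - s/2 < pi"
    using assms by linarith+
  ultimately have "t/2 - s/2 = 0"
    using sin_eq_0_pi by blast
  then show ?thesis by simp
qed

lemma psi_nonzero: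
  assumes "0 < t" "t < 2 * pi" "t \<noteq> pi"
  shows "psi t \<noteq> 0"
  \<comment> \<open>\<open>psi pi = 0\<close>, since \<open>sin pi = 0\<close> and \<open>x / 0 = 0\<close>; injectivity rules out any other zero.\<close>
  using psi_inj[of t pi] assms by (auto simp: psi_def cot_def)

lemma angle_at_bounds:
  assumes "\<not> collinear {A, V, B}"
  shows "0 < angle_at A V B" "angle_at A V B < pi"
proof -
  let ?u = "A - V" and ?v = "B - V"
  have "\<bar>?u \<bullet> ?v\<bar> \<noteq> norm ?u * norm ?v"
    using assms norm_cauchy_schwarz_equal[of ?u ?v] collinear_3[of A V B] by simp
  then have lt: "\<bar>?u \<bullet> ?v\<bar> < norm ?u * norm ?v"
    using Cauchy_Schwarz_ineq2[of ?u ?v] by linarith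
  then have "0 < norm ?u * norm ?v" by linarith
  with lt have "\<bar>(?u \<bullet> ?v) / (norm ?u * norm ?v)\<bar> < 1"
    by (simp add: abs_divide)
  then show "0 < angle_at A V B" "angle_at A V B < pi"
    unfolding angle_at_def
    using arccos_lt_bounded[of "(?u \<bullet> ?v) / (norm ?u * norm ?v)"] unfolding abs_less_iff
    by linarith+
qed

lemma cos_angle_at:
  "cos (angle_at A V B) = ((A - V) \<bullet> (B - V)) / (norm (A - V) * norm (B - V))"
proof -
  have "\<bar>((A - V) \<bullet> (B - V)) / (norm (A - V) * norm (B - V))\<bar> \<le> 1"
    using Cauchy_Schwarz_ineq2[of "A - V" "B - V"]
    by (auto simp: abs_divide abs_mult divide_le_eq_1 less_le)
  then show ?thesis
    unfolding angle_at_def abs_le_iff by (intro cos_arccos) linarith+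
qed

text \<open>
  Put \<open>u = V - A\<close> and \<open>v = B - V\<close>, so \<open>B - A = u + v\<close>. Equality of the two cosines says that
  \<open>u + v\<close> has the same component along \<open>u\<close> as along \<open>v\<close>, which rearranges to
  \<open>(|u| - |v|) (|u| |v| - u \<bullet> v) = 0\<close>; the second factor is positive by the strict
  Cauchy-Schwarz inequality.
\<close>
lemma isosceles_if_cos_angles_eq:
  assumes nc: "\<not> collinear {A, V, B}"
    and eq: "cos (angle_at B A V) = cos (angle_at A B V)"
  shows "dist A V = dist V B"
proof -
  define u v where "u = V - A" and "v = B - V"
  have w: "B - A = u + v" "A - B = - (u + v)" "V - A = u" "V - B = - v"
    by (simp_all add: u_def v_def)
  have "collinear {A, V, B} \<longleftrightarrow> collinear {0, - u, v}"
    using collinear_3[of A V B] by (simp add: u_def v_def)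
  then have "\<bar>u \<bullet> v\<bar> \<noteq> norm u * norm v"
    using nc norm_cauchy_schwarz_equal[of "- u" v] by simp
  then have lt: "u \<bullet> v < norm u * norm v"
    using Cauchy_Schwarz_ineq2[of u v] by linarith
  have "A \<noteq> V" "V \<noteq> B" "A \<noteq> B"
    using nc by (auto simp: insert_commute)
  then have pos: "norm u > 0" "norm v > 0" "norm (u + v) > 0"
    by (auto simp: u_def v_def)
  have "((u + v) \<bullet> u) / (norm (u + v) * norm u) = ((u + v) \<bullet> v) / (norm (u + v) * norm v)"
    using eq unfolding cos_angle_at w by (simp only: norm_minus_cancel inner_minus_left
      inner_minus_right minus_minus)
  then have "((u + v) \<bullet> u) * norm v = ((u + v) \<bullet> v) * norm u"
    using pos by (simp add: frac_eq_eq)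
  then have "(norm u * norm u + u \<bullet> v) * norm v = (u \<bullet> v + norm v * norm v) * norm u"
    by (simp add: inner_add_left inner_commute[of v u] flip: power2_eq_square power2_norm_eq_inner)
  then have "(norm u - norm v) * (norm u * norm v - u \<bullet> v) = 0"
    by (simp add: algebra_simps)
  then have "norm u = norm v"
    using lt by simp
  then show ?thesis
    by (simp add: u_def v_def dist_norm norm_minus_commute)
qed

lemma interior_angle_bounds:
  assumes "is_polygon N p P"
  shows "0 < interior_angle p P i" "interior_angle p P i < 2 * pi" "interior_angle p P i \<noteq> pi"
proof -
  have "\<not> collinear {p (i - 1), p i, p (i + 1)}"
    using assms by (simp add: is_polygon_def)
  from angle_at_bounds[OF this]
  show "0 < interior_angle p P i" "interior_angle p P i < 2 * pi" "interior_angle p P i \<noteq> pi"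
    unfolding interior_angle_def using pi_gt_zero by auto
qed

lemma consecutive_eq_imp_const:
  fixes f :: "int \<Rightarrow> 'a"
  assumes "\<And>i. a \<le> i \<Longrightarrow> i < b \<Longrightarrow> f i = f (i + 1)" and "i \<in> {a..b}"
  shows "f i = f a"
proof -
  have "a \<le> i" using assms(2) by simp
  then have "i \<le> b \<longrightarrow> f i = f a"
    by (induction i rule: int_ge_induct) (use assms(1) in force)+
  then show ?thesis using assms(2) by simp
qed

lemma interior_angles_eq_if_psi_eq:
  assumes "is_polygon N p P"
    and "\<forall>i\<in>{1..int N}. psi (interior_angle p P i) - psi (interior_angle p P (i + 1)) = 0"
    and "i \<in> {1..int N}"
  shows "interior_angle p P i = interior_angle p P 1"
proof (rule consecutive_eq_imp_const[OF _ assms(3)])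
  fix i :: int assume "1 \<le> i" "i < int N"
  then have "psi (interior_angle p P i) = psi (interior_angle p P (i + 1))"
    using assms(2) by simp
  then show "interior_angle p P i = interior_angle p P (i + 1)"
    by (rule psi_inj[rotated 4]) (rule interior_angle_bounds[OF assms(1)])+
qed

lemma regular_polygonI:
  assumes "is_polygon N p P"
    and "\<And>i. i \<in> {1..int N} \<Longrightarrow> side_length p i = l"
    and "\<And>i. i \<in> {1..int N} \<Longrightarrow> interior_angle p P i = \<theta>"
  shows "is_regular_polygon N p P"
  using assms by (simp add: is_regular_polygon_def)

theorem mainTheorem1:
  fixes N :: nat and p :: "int \<Rightarrow> real^2" and P :: "(real^2) set"
  assumes "N \<ge> 3" and "is_polygon N p P"
  shows "((\<forall>i\<in>{1..int N}.
             1 / side_length p i * (psi (interior_angle p P i) + psi (interior_angle p P (i + 1)))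
               = perimeter N p / (2 * area P) \<and>
             psi (interior_angle p P i) - psi (interior_angle p P (i + 1)) = 0)
           \<longrightarrow> is_regular_polygon N p P)
       \<and> ((\<forall>i\<in>{1..int N}.
             psi (interior_angle p P i) - psi (interior_angle p P (i + 1)) = 0 \<and>
             cos (alpha_minus p i) - cos (alpha_plus p i) = 0)
           \<longrightarrow> is_regular_polygon N p P)"
proof (intro conjI impI)
  let ?r = "perimeter N p / (2 * area P)"
  let ?c = "psi (interior_angle p P 1)"
  assume *: "\<forall>i\<in>{1..int N}.
             1 / side_length p i * (psi (interior_angle p P i) + psi (interior_angle p P (i + 1)))
               = ?r \<and>
             psi (interior_angle p P i) - psi (interior_angle p P (i + 1)) = 0"
  then have angles: "interior_angle p P i = interior_angle p P 1" if "i \<in> {1..int N}" for i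
    using interior_angles_eq_if_psi_eq[OF assms(2)] that by blast
  have "?c \<noteq> 0"
    by (intro psi_nonzero interior_angle_bounds[OF assms(2)])
  have "side_length p i = 2 * ?c / ?r" if i: "i \<in> {1..int N}" for i
  proof -
    have "psi (interior_angle p P i) = ?c" "psi (interior_angle p P (i + 1)) = ?c"
      using bspec[OF * i] angles[OF i] by simp_all
    moreover have "1 / side_length p i *
        (psi (interior_angle p P i) + psi (interior_angle p P (i + 1))) = ?r"
      using bspec[OF * i] by (rule conjunct1)
    ultimately have r: "?r = 2 * ?c / side_length p i"
      by simp
    show ?thesis
      unfolding r using \<open>?c \<noteq> 0\<close> by simp
  qed
  then show "is_regular_polygon N p P"
    using angles by (rule regular_polygonI[OF assms(2)])
next
  assume *: "\<forall>i\<in>{1..int N}.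
             psi (interior_angle p P i) - psi (interior_angle p P (i + 1)) = 0 \<and>
             cos (alpha_minus p i) - cos (alpha_plus p i) = 0"
  then have angles: "interior_angle p P i = interior_angle p P 1" if "i \<in> {1..int N}" for i
    using interior_angles_eq_if_psi_eq[OF assms(2)] that by blast
  have "side_length p i = side_length p 1" if "i \<in> {1..int N}" for i
  proof (rule consecutive_eq_imp_const[OF _ that])
    fix i :: int assume i: "1 \<le> i" "i < int N"
    \<comment> \<open>The sides \<open>i\<close> and \<open>i + 1\<close> meet at vertex \<open>i + 1\<close>.\<close>
    have "\<not> collinear {p (i + 1 - 1), p (i + 1), p (i + 1 + 1)}"
      using assms(2) unfolding is_polygon_def by blast
    moreover have "cos (alpha_minus p (i + 1)) = cos (alpha_plus p (i + 1))"
      using * i by simp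
    ultimately have "dist (p (i + 1 - 1)) (p (i + 1)) = dist (p (i + 1)) (p (i + 1 + 1))"
      unfolding alpha_minus_def alpha_plus_def by (rule isosceles_if_cos_angles_eq)
    then show "side_length p i = side_length p (i + 1)"
      by (simp add: side_length_def)
  qed
  then show "is_regular_polygon N p P"
    using angles by (rule regular_polygonI[OF assms(2)])
qed

end
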